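(* Let $\mathcal{C}$ be the class of densities $$\mathcal{C}=\Big\{p(\boldsymbol{x},\boldsymbol{y}|\boldsymbol{\vartheta}) :\ p(\boldsymbol{x},\boldsymbol{y}|\boldsymbol{\vartheta})=\sum_{g=1}^{G}\phi_d\big(\boldsymbol{y}|\boldsymbol{x},\boldsymbol{\mu}_{\boldsymbol{Y}}(\boldsymbol{x}|\boldsymbol{B}_g),\boldsymbol{\Sigma}_{\boldsymbol{Y}g}\big)\,\phi_p\big(\boldsymbol{x}|\boldsymbol{\mu}_{\boldsymbol{X}g},\boldsymbol{\Sigma}_{\boldsymbol{X}g}\big)\,\pi_g,\ \text{with } \pi_g>0,\ \sum_{g=1}^G\pi_g=1,$$ $$(\boldsymbol{B}_g,\boldsymbol{\Sigma}_{\boldsymbol{Y}g})\neq(\boldsymbol{B}_j,\boldsymbol{\Sigma}_{\boldsymbol{Y}j})\text{ for } g\neq j,\ (\boldsymbol{x},\boldsymbol{y})\in\mathbb{R}^{p+d},\ \boldsymbol{\vartheta}=\{\boldsymbol{B}_g,\boldsymbol{\Sigma}_{\boldsymbol{Y}g},\boldsymbol{\mu}_{\boldsymbol{X}g},\boldsymbol{\Sigma}_{\boldsymbol{X}g},\pi_g;\ g=1,\dots,G\}\in\boldsymbol{\varTheta},\ G\in\mathbb{N}\Big\}.$$ Assume that there exists a set $\mathcal{X}\subseteq\mathbb{R}^p$ having probability equal to one according to the $p$-variate Gaussian distribution such that the mixture of regression models $$\sum_{g=1}^G\phi_d\big(\boldsymbol{y}|\boldsymbol{x},\boldsymbol{\mu}_{\boldsymbol{Y}}(\boldsymbol{x}|\boldsymbol{B}_g),\boldsymbol{\Sigma}_{\boldsymbol{Y}g}\big)\,\alpha_g(\boldsymbol{x}),\qquad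 \boldsymbol{y}\in\mathbb{R}^d,$$ is identifiable for each fixed $\boldsymbol{x}\in\mathcal{X}$, where $\alpha_1(\boldsymbol{x}),\dots,\alpha_G(\boldsymbol{x})$ are positive weights summing to one for each $\boldsymbol{x}\in\mathcal{X}$. Then the class $\mathcal{C}$ is identifiable in $\mathcal{X}\times\mathbb{R}^d$.
   Context: For $q\ge 1$, $\phi_q$ denotes the density of a $q$-variate Gaussian random vector with the indicated mean and covariance matrix; a prime denotes transpose. The covariate vector $\boldsymbol{x}$ takes values in $\mathbb{R}^p$ and the response vector $\boldsymbol{y}$ in $\mathbb{R}^d$. In component $g$, the covariates have mean $\boldsymbol{\mu}_{\boldsymbol{X}g}\in\mathbb{R}^p$ and covariance matrix $\boldsymbol{\Sigma}_{\boldsymbol{X}g}$ ($p\times p$), and, given $\boldsymbol{x}$, the response has covariance matrix $\boldsymbol{\Sigma}_{\boldsymbol{Y}g}$ ($d\times d$) and mean $\boldsymbol{\mu}_{\boldsymbol{Y}}(\boldsymbol{x}|\boldsymbol{B}_g)=\boldsymbol{B}_g'\boldsymbol{x}^*$, where $\boldsymbol{B}_g\in\mathbb{R}^{(1+p)\times d}$ and $\boldsymbol{x}^*=(1,\boldsymbol{x}')'$. The $\pi_g$ are mixing weights and $\boldsymbol{\varTheta}$ is the parameter space. Identifiability: let $\{f(\boldsymbol{z}|\boldsymbol{\psi}):\boldsymbol{z}\in\mathcal{Z},\boldsymbol{\psi}\in\boldsymbol{\Psi}\}$ be a parametric class of densities, and consider the class of finite mixtures $h(\boldsymbol{z}|\boldsymbol{\vartheta})=\sum_{g=1}^G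 f(\boldsymbol{z}|\boldsymbol{\psi}_g)\pi_g$, $\boldsymbol{z}\in\mathcal{Z}$, with $G\in\mathbb{N}$, $\pi_g>0$, $\sum_g\pi_g=1$ and $\boldsymbol{\psi}_g\neq\boldsymbol{\psi}_j$ for $g\neq j$. This class is identifiable if, for any two members $h(\boldsymbol{z}|\boldsymbol{\vartheta})=\sum_{g=1}^{G}f(\boldsymbol{z}|\boldsymbol{\psi}_g)\pi_g$ and $h(\boldsymbol{z}|\widetilde{\boldsymbol{\vartheta}})=\sum_{s=1}^{\widetilde G}f(\boldsymbol{z}|\widetilde{\boldsymbol{\psi}}_s)\widetilde\pi_s$, the equality $h(\boldsymbol{z}|\boldsymbol{\vartheta})=h(\boldsymbol{z}|\widetilde{\boldsymbol{\vartheta}})$ implies that $G=\widetilde G$ and that for each $g\in\{1,\dots,G\}$ there exists $s\in\{1,\dots,G\}$ such that $\pi_g=\widetilde\pi_s$ and $\boldsymbol{\psi}_g=\widetilde{\boldsymbol{\psi}}_s$. For the mixture of regression models at fixed $\boldsymbol{x}$, the variable is $\boldsymbol{y}\in\mathbb{R}^d$, the component parameters are $(\boldsymbol{B}_g,\boldsymbol{\Sigma}_{\boldsymbol{Y}g})$ and the weights are $\alpha_g(\boldsymbol{x})$. For $\mathcal{C}$, the variable is $(\boldsymbol{x},\boldsymbol{y})\in\mathcal{X}\times\mathbb{R}^d$, the component parameters are $(\boldsymbol{B}_g,\boldsymbol{\Sigma}_{\boldsymbol{Y}g},\boldsymbol{\mu}_{\boldsymbol{X}g},\boldsymbol{\Sigma}_{\boldsymbol{X}g})$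 and the weights are $\pi_g$; in other words, the conclusion is that $\mathcal{C}$ is identifiable for almost all $\boldsymbol{x}\in\mathbb{R}^p$ and for all $\boldsymbol{y}\in\mathbb{R}^d$. *)

theory Defs
  imports "HOL-Analysis.Analysis"
begin

section \<open>Gaussian densities\<close>

definition positive_definite :: "real ^ 'n ^ 'n \<Rightarrow> bool" where
  "positive_definite S \<longleftrightarrow> transpose S = S \<and> (\<forall>v. v \<noteq> 0 \<longrightarrow> v \<bullet> (S *v v) > 0)"

definition gaussian_density :: "real ^ 'n \<Rightarrow> real ^ 'n ^ 'n \<Rightarrow> real ^ 'n \<Rightarrow> real" where
  "gaussian_density m S z =
     exp (- ((z - m) \<bullet> (matrix_inv S *v (z - m))) / 2) / sqrt ((2 * pi) ^ CARD('n) * det S)"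

definition gaussian_measure :: "real ^ 'n \<Rightarrow> real ^ 'n ^ 'n \<Rightarrow> (real ^ 'n) measure" where
  "gaussian_measure m S = density lborel (\<lambda>z. ennreal (gaussian_density m S z))"


section \<open>Finite mixtures and identifiability\<close>

text \<open>
  A finite mixture with \<open>G\<close> components is represented by the list of length \<open>G\<close> of its pairs
  (component parameter, weight). No condition \<open>G \<ge> 1\<close> is needed in \<open>is_mixture\<close>: the weights
  of the empty list do not sum to one.
\<close>

definition mixture_density :: "('c \<Rightarrow> 'z \<Rightarrow> real) \<Rightarrow> ('c \<times> real) list \<Rightarrow> 'z \<Rightarrow> real" where
  "mixture_density f \<theta> z = (\<Sum>(\<psi>, w)\<leftarrow>\<theta>. f \<psi> z * w)"

definition is_mixture :: "('c \<times> real) list \<Rightarrow> bool" where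
  "is_mixture \<theta> \<longleftrightarrow>
     (\<forall>(\<psi>, w)\<in>set \<theta>. w > 0) \<and> (\<Sum>(\<psi>, w)\<leftarrow>\<theta>. w) = 1 \<and> distinct (map fst \<theta>)"

definition identifiable_on :: "'z set \<Rightarrow> ('c \<Rightarrow> 'z \<Rightarrow> real) \<Rightarrow> ('c \<times> real) list set \<Rightarrow> bool" where
  "identifiable_on Z f M \<longleftrightarrow>
     (\<forall>\<theta>\<in>M. \<forall>\<theta>'\<in>M. (\<forall>z\<in>Z. mixture_density f \<theta> z = mixture_density f \<theta>' z) \<longrightarrow>
        length \<theta> = length \<theta>' \<and>
        (\<forall>g<length \<theta>. \<exists>s<length \<theta>'. snd (\<theta> ! g) = snd (\<theta>' ! s) \<and> fst (\<theta> ! g) = fst (\<theta>' ! s)))"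


section \<open>Gaussian cluster-weighted models\<close>

text \<open>
  The rows of the coefficient matrix \<open>B\<close>, of size \<open>(1 + p) \<times> d\<close>, are indexed by the type
  \<open>'p option\<close>, the intercept row having index \<open>None\<close>. A regression parameter is the pair
  \<open>(B, \<Sigma>\<^sub>Y)\<close>, a covariate parameter the pair \<open>(\<mu>\<^sub>X, \<Sigma>\<^sub>X)\<close>.
\<close>

type_synonym ('p, 'd) regression_param = "(real ^ 'd ^ 'p option) \<times> (real ^ 'd ^ 'd)"
type_synonym 'p covariate_param = "(real ^ 'p) \<times> (real ^ 'p ^ 'p)"
type_synonym ('p, 'd) cwm_param = "('p, 'd) regression_param \<times> 'p covariate_param"

definition augment :: "real ^ 'p \<Rightarrow> real ^ 'p option" where
  "augment x = (\<chi> i. case i of None \<Rightarrow> 1 | Some j \<Rightarrow> x $ j)"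

definition regression_mean :: "real ^ 'd ^ 'p option \<Rightarrow> real ^ 'p \<Rightarrow> real ^ 'd" where
  "regression_mean B x = transpose B *v augment x"

fun regression_density :: "real ^ 'p \<Rightarrow> ('p, 'd) regression_param \<Rightarrow> real ^ 'd \<Rightarrow> real" where
  "regression_density x (B, S) y = gaussian_density (regression_mean B x) S y"

fun cwm_density :: "('p, 'd) cwm_param \<Rightarrow> (real ^ 'p) \<times> (real ^ 'd) \<Rightarrow> real" where
  "cwm_density (r, (m, T)) (x, y) = regression_density x r y * gaussian_density m T x"

text \<open>
  The class of joint densities, given by its parameters. The parameter space \<open>\<Theta>\<close> is an arbitrary
  set of whole mixtures, so that it may impose constraints linking different components.
\<close>

definition cwm_class ::
    "(('p::finite, 'd::finite) cwm_param \<times> real) list set \<Rightarrow> (('p, 'd) cwm_param \<times> real) list set" where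
  "cwm_class \<Theta> = {\<theta> \<in> \<Theta>. is_mixture \<theta> \<and> distinct (map (fst \<circ> fst) \<theta>) \<and>
     (\<forall>(((B, S), (m, T)), w)\<in>set \<theta>. positive_definite S \<and> positive_definite T)}"

text \<open>
  The mixtures of regression models with components \<open>(B\<^sub>g, \<Sigma>\<^sub>Y\<^sub>g)\<close>, \<open>g = 1, \<dots>, G\<close>, coming from a
  member of the above class. For a fixed value \<open>x\<close> of the covariates, the weights \<open>\<alpha>\<^sub>g(x)\<close> are
  arbitrary positive numbers summing to one.
\<close>

definition regression_class ::
    "(('p::finite, 'd::finite) cwm_param \<times> real) list set \<Rightarrow> (('p, 'd) regression_param \<times> real) list set" where
  "regression_class \<Theta> =
     {\<rho>. is_mixture \<rho> \<and> (\<exists>\<theta>\<in>cwm_class \<Theta>. map fst \<rho> = map (fst \<circ> fst) \<theta>)}"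

end

theory Submission
  imports Defs "HOL-Probability.Distributions"
begin

text \<open>
  Integrating out \<open>y\<close> shows that two members of the class with the same joint density on
  \<open>X \<times> \<real>\<^sup>d\<close> have the same covariate marginal on \<open>X\<close>. Dividing by it turns them, for each
  fixed \<open>x \<in> X\<close>, into two equal mixtures of regressions, whose weights are the posterior
  probabilities of the components given \<open>x\<close>. Identifiability at \<open>x\<close> matches the components; since the
  regression parameters within a mixture are distinct, the matching does not depend on \<open>x\<close>.
  So matched components satisfy \<open>\<phi>(x | \<mu>, \<Sigma>) \<pi> = \<phi>(x | \<mu>', \<Sigma>') \<pi>'\<close> on \<open>X\<close>, which has a
  Lebesgue-null complement; by continuity this holds everywhere, integration gives \<open>\<pi> = \<pi>'\<close>, and
  the mode and the quadratic form of a Gaussian density determine its parameters.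
\<close>

section \<open>Linear change of variables for Lebesgue measure\<close>

text \<open>Split off the coordinate along \<open>i\<close> by Fubini. Because \<open>j\<close>
  differs from \<open>i\<close>, the amount \<open>x j\<close> added to that coordinate is constant
  in the inner integral, so the shear acts there as a translation of the real line.\<close>

lemma nn_integral_lborel_shear:
  fixes g :: "'a::euclidean_space \<Rightarrow> ennreal"
  assumes [measurable]: "g \<in> borel_measurable borel"
    and i: "i \<in> Basis" and j: "j \<in> Basis" and "i \<noteq> j"
  shows "(\<integral>\<^sup>+x. g (x + (x \<bullet> j) *\<^sub>R i) \<partial>lborel) = (\<integral>\<^sup>+x. g x \<partial>lborel)"
proof -
  interpret product_sigma_finite "\<lambda>_::'a. lborel :: real measure" ..
  define I where "I = Basis - {i}"
  have I: "Basis = insert i I" "finite I" "i \<notin> I" "j \<in> I"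
    using i j \<open>i \<noteq> j\<close> by (auto simp: I_def)
  have iter: "(\<integral>\<^sup>+x. h x \<partial>lborel) =
      (\<integral>\<^sup>+x. \<integral>\<^sup>+y. h ((\<Sum>b\<in>I. x b *\<^sub>R b) + y *\<^sub>R i) \<partial>lborel \<partial>(\<Pi>\<^sub>M b\<in>I. lborel))"
    \<comment> \<open>The iterated form is proved for a general \<open>h\<close>, since it is
      applied both to the sheared integrand and to \<open>g\<close> itself.\<close>
    if [measurable]: "h \<in> borel_measurable borel" for h :: "'a \<Rightarrow> ennreal"
  proof -
    have sum: "(\<Sum>b\<in>insert i I. (x(i := y)) b *\<^sub>R b) = (\<Sum>b\<in>I. x b *\<^sub>R b) + y *\<^sub>R i"
      for x :: "'a \<Rightarrow> real" and y
    proof -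
      have "(\<Sum>b\<in>I. (x(i := y)) b *\<^sub>R b) = (\<Sum>b\<in>I. x b *\<^sub>R b)"
        using I(3) by (intro sum.cong) auto
      then show ?thesis using I(2,3) by simp
    qed
    have "(\<integral>\<^sup>+x. h x \<partial>lborel) =
        (\<integral>\<^sup>+x. h (\<Sum>b\<in>insert i I. x b *\<^sub>R b) \<partial>(\<Pi>\<^sub>M b\<in>insert i I. lborel))"
      by (subst lborel_eq, subst nn_integral_distr) (simp_all add: I(1))
    also have "\<dots> = (\<integral>\<^sup>+x. \<integral>\<^sup>+y. h (\<Sum>b\<in>insert i I. (x(i := y)) b *\<^sub>R b) \<partial>lborel \<partial>(\<Pi>\<^sub>M b\<in>I. lborel))"
      using I(2,3) by (intro product_nn_integral_insert) auto
    finally show ?thesis by (simp only: sum)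
  qed
  have inner_j: "((\<Sum>b\<in>I. x b *\<^sub>R b) + y *\<^sub>R i) \<bullet> j = x j" for x :: "'a \<Rightarrow> real" and y
  proof -
    have "(\<Sum>b\<in>I. x b * (b \<bullet> j)) = (\<Sum>b\<in>I. if b = j then x b else 0)"
      using j by (intro sum.cong) (auto simp: I_def inner_Basis)
    then show ?thesis
      using I(2,4) i j \<open>i \<noteq> j\<close> by (simp add: inner_add_left inner_sum_left inner_Basis)
  qed
  have "(\<integral>\<^sup>+x. g (x + (x \<bullet> j) *\<^sub>R i) \<partial>lborel) =
      (\<integral>\<^sup>+x. \<integral>\<^sup>+y. g ((\<Sum>b\<in>I. x b *\<^sub>R b) + (x j + 1 * y) *\<^sub>R i) \<partial>lborel \<partial>(\<Pi>\<^sub>M b\<in>I. lborel))"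
    by (subst iter) (simp, simp only: inner_j, simp add: scaleR_add_left add_ac)
  also have "\<dots> = (\<integral>\<^sup>+x. \<integral>\<^sup>+y. g ((\<Sum>b\<in>I. x b *\<^sub>R b) + y *\<^sub>R i) \<partial>lborel \<partial>(\<Pi>\<^sub>M b\<in>I. lborel))"
  proof (rule nn_integral_cong)
    fix x :: "'a \<Rightarrow> real"
    show "(\<integral>\<^sup>+y. g ((\<Sum>b\<in>I. x b *\<^sub>R b) + (x j + 1 * y) *\<^sub>R i) \<partial>lborel) =
        (\<integral>\<^sup>+y. g ((\<Sum>b\<in>I. x b *\<^sub>R b) + y *\<^sub>R i) \<partial>lborel)"
      using nn_integral_real_affine[of "\<lambda>y. g ((\<Sum>b\<in>I. x b *\<^sub>R b) + y *\<^sub>R i)" 1 "x j"] by simp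
  qed
  also have "\<dots> = (\<integral>\<^sup>+x. g x \<partial>lborel)"
    by (rule iter[symmetric]) simp
  finally show ?thesis .
qed

text \<open>
  The change-of-variables theorems of the library require the index type to be a wellorder, so they do
  not apply to an arbitrary finite \<open>'n\<close>.
\<close>

lemma nn_integral_lborel_linear:
  fixes f :: "real ^ 'n \<Rightarrow> real ^ 'n" and g :: "real ^ 'n \<Rightarrow> ennreal"
  assumes "linear f" and "det (matrix f) \<noteq> 0" and "g \<in> borel_measurable borel"
  shows "(\<integral>\<^sup>+x. g x \<partial>lborel) = ennreal \<bar>det (matrix f)\<bar> * (\<integral>\<^sup>+x. g (f x) \<partial>lborel)"
proof -
  let ?Q = "\<lambda>f :: real ^ 'n \<Rightarrow> real ^ 'n. \<lambda>g. (\<integral>\<^sup>+x. g x \<partial>lborel) =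
      ennreal \<bar>det (matrix f)\<bar> * (\<integral>\<^sup>+x. g (f x) \<partial>lborel)"
  let ?P = "\<lambda>f :: real ^ 'n \<Rightarrow> real ^ 'n. det (matrix f) \<noteq> 0 \<longrightarrow>
      (\<forall>g \<in> borel_measurable borel. ?Q f g)"
  \<comment> \<open>Every linear map is built from elementary ones. Keeping \<open>g\<close>
    quantified inside \<open>?P\<close> lets the composition case use the formula for
    \<open>f\<close> at \<open>g\<close> and then the formula for \<open>h\<close> at
    \<open>g\<close> composed with \<open>f\<close>.\<close>
  have "?P f"
  proof (rule induct_linear_elementary[OF \<open>linear f\<close>]; intro impI ballI)
    fix f h :: "real ^ 'n \<Rightarrow> real ^ 'n" and g :: "real ^ 'n \<Rightarrow> ennreal"
    assume lin: "linear f" "linear h" and P: "?P f" "?P h"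
      and nz: "det (matrix (f \<circ> h)) \<noteq> 0" and g[measurable]: "g \<in> borel_measurable borel"
    have [measurable]: "f \<in> borel_measurable borel"
      using lin(1) by (simp add: borel_measurable_continuous_onI linear_continuous_on linear_conv_bounded_linear)
    have eq: "det (matrix (f \<circ> h)) = det (matrix f) * det (matrix h)"
      using matrix_compose[OF lin(2,1)] by (simp add: det_mul)
    then have nz': "det (matrix f) \<noteq> 0" "det (matrix h) \<noteq> 0" using nz by auto
    have "(\<integral>\<^sup>+x. g x \<partial>lborel) = ennreal \<bar>det (matrix f)\<bar> * (\<integral>\<^sup>+x. g (f x) \<partial>lborel)"
      using P(1) nz' g by blast
    also have "(\<integral>\<^sup>+x. g (f x) \<partial>lborel) = ennreal \<bar>det (matrix h)\<bar> * (\<integral>\<^sup>+x. g (f (h x)) \<partial>lborel)"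
    proof -
      have "(\<lambda>x. g (f x)) \<in> borel_measurable borel" by simp
      then show ?thesis using P(2) nz' by blast
    qed
    finally show "?Q (f \<circ> h) g"
      by (simp add: eq abs_mult ennreal_mult mult.assoc)
  next
    fix f :: "real ^ 'n \<Rightarrow> real ^ 'n" and i and g :: "real ^ 'n \<Rightarrow> ennreal"
    assume "linear f" and 0: "\<And>x. f x $ i = 0" and nz: "det (matrix f) \<noteq> 0"
    \<comment> \<open>A map whose \<open>i\<close>-th component vanishes misses every vector with a
      nonzero \<open>i\<close>-th entry, so it is not surjective and hence not injective; this
      contradicts the nonzero determinant.\<close>
    have "\<not> inj f"
      by (metis (full_types) \<open>linear f\<close> 0 linear_injective_imp_surjective one_neq_zero surjE vec_component)
    then show "?Q f g" using det_nz_iff_inj[OF \<open>linear f\<close>] nz by blast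
  next
    fix c :: "'n \<Rightarrow> real" and g :: "real ^ 'n \<Rightarrow> ennreal"
    let ?h = "\<lambda>x::real ^ 'n. \<chi> i. c i * x $ i"
    assume nz: "det (matrix ?h) \<noteq> 0" and g[measurable]: "g \<in> borel_measurable borel"
    have det: "det (matrix ?h) = (\<Prod>i\<in>UNIV. c i)"
      by (subst det_diagonal) (auto simp: matrix_def axis_def)
    \<comment> \<open>The affine formula for \<open>lborel\<close> takes scale factors indexed by
      basis vectors, so \<open>d\<close> recovers the index of a basis vector and returns the value
      of \<open>c\<close> there. The zero translation in \<open>h\<close> below fits the same
      formula.\<close>
    define d where "d = (\<lambda>b::real ^ 'n. c (THE i. b = axis i 1))"
    have d: "d (axis i 1) = c i" for i by (simp add: d_def axis_eq_axis)
    have BB: "(Basis :: (real ^ 'n) set) = (\<lambda>i. axis i 1) ` UNIV"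
      by (auto simp: Basis_vec_def)
    have inj: "inj (\<lambda>i::'n. axis i (1::real))" by (auto simp: inj_def axis_eq_axis)
    have h: "?h x = 0 + (\<Sum>j\<in>Basis. (d j * (x \<bullet> j)) *\<^sub>R j)" for x
    proof -
      have "(\<Sum>j\<in>Basis. (d j * (x \<bullet> j)) *\<^sub>R j) = (\<Sum>i\<in>UNIV. (c i * x $ i) *\<^sub>R axis i 1)"
        unfolding BB sum.reindex[OF inj] by (simp add: d inner_axis)
      then show ?thesis
        by (simp add: vec_eq_iff axis_def if_distrib cong: if_cong)
    qed
    have prod: "(\<Prod>j\<in>Basis. \<bar>d j\<bar>) = \<bar>det (matrix ?h)\<bar>"
      by (simp add: det BB prod.reindex[OF inj] d abs_prod)
    have "lborel = density (distr lborel borel ?h) (\<lambda>_. ennreal \<bar>det (matrix ?h)\<bar>)"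
      unfolding h[abs_def] prod[unfolded h[abs_def], symmetric]
      using nz by (intro lborel_affine_euclidean) (auto simp: BB d det)
    then have "(\<integral>\<^sup>+x. g x \<partial>lborel) =
        (\<integral>\<^sup>+x. g x \<partial>density (distr lborel borel ?h) (\<lambda>_. ennreal \<bar>det (matrix ?h)\<bar>))"
      by simp
    also have "\<dots> = ennreal \<bar>det (matrix ?h)\<bar> * (\<integral>\<^sup>+x. g (?h x) \<partial>lborel)"
    proof -
      have [measurable]: "?h \<in> borel_measurable borel"
        by (intro borel_measurable_continuous_onI continuous_intros)
      show ?thesis by (simp add: nn_integral_density nn_integral_distr nn_integral_cmult)
    qed
    finally show "?Q ?h g" .
  next
    fix m n :: 'n and g :: "real ^ 'n \<Rightarrow> ennreal"
    let ?h = "\<lambda>v::real ^ 'n. \<chi> i. v $ Transposition.transpose m n i"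
    assume "m \<noteq> n" and g[measurable]: "g \<in> borel_measurable borel"
    have [measurable]: "?h \<in> borel_measurable borel"
      by (intro borel_measurable_continuous_onI continuous_intros)
    have "matrix ?h = transpose (\<chi> i j. mat 1 $ i $ Transposition.transpose m n j)"
      by (auto simp: transpose_def axis_def mat_def matrix_def vec_eq_iff)
    then have det: "\<bar>det (matrix ?h)\<bar> = 1"
      by (simp add: det_permute_columns permutes_swap_id sign_swap_id abs_mult)
    \<comment> \<open>Lebesgue measure is determined by its values on boxes, and swapping two
      coordinates only permutes the side lengths of a box.\<close>
    have "lborel = distr lborel borel ?h"
    proof (rule lborel_eqI)
      fix l u :: "real ^ 'n"
      assume le: "\<And>b. b \<in> Basis \<Longrightarrow> l \<bullet> b \<le> u \<bullet> b"
      then have le': "l $ i \<le> u $ i" for i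
        using le[of "axis i 1"] by (auto simp: Basis_vec_def inner_axis)
      have hh: "?h (?h v) = v" for v by (simp add: vec_eq_iff)
      have pre: "?h -` box l u = box (?h l) (?h u)"
        by (auto simp: mem_box_cart) (metis transpose_involutory)+
      have "emeasure (distr lborel borel ?h) (box l u) = emeasure lborel (box (?h l) (?h u))"
        by (simp add: emeasure_distr pre)
      also have "\<dots> = ennreal (\<Prod>b\<in>Basis. (?h u - ?h l) \<bullet> b)"
        by (rule emeasure_lborel_box) (auto simp: Basis_vec_def inner_axis le')
      also have "(\<Prod>b\<in>Basis. (?h u - ?h l) \<bullet> b) = (\<Prod>i\<in>UNIV. (?h u - ?h l) $ i)"
        by (simp add: Basis_vec_def UNION_singleton_eq_range inner_axis prod.reindex inj_def axis_eq_axis)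
      also have "\<dots> = (\<Prod>i\<in>UNIV. (u - l) $ i)"
        using prod.permute[OF permutes_swap_id, where S=UNIV and g="\<lambda>i. (u - l) $ i", symmetric]
        by (simp add: o_def)
      also have "\<dots> = (\<Prod>b\<in>Basis. (u - l) \<bullet> b)"
        by (simp add: Basis_vec_def UNION_singleton_eq_range inner_axis prod.reindex inj_def axis_eq_axis)
      finally show "emeasure (distr lborel borel ?h) (box l u) = (\<Prod>b\<in>Basis. (u - l) \<bullet> b)" .
    qed simp
    then have "(\<integral>\<^sup>+x. g x \<partial>lborel) = (\<integral>\<^sup>+x. g x \<partial>distr lborel borel ?h)" by simp
    also have "\<dots> = (\<integral>\<^sup>+x. g (?h x) \<partial>lborel)" by (simp add: nn_integral_distr)
    finally show "?Q ?h g" by (simp add: det)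
  next
    fix m n :: 'n and g :: "real ^ 'n \<Rightarrow> ennreal"
    let ?h = "\<lambda>v::real ^ 'n. \<chi> i. if i = m then v $ m + v $ n else v $ i"
    assume "m \<noteq> n" and g: "g \<in> borel_measurable borel"
    have h: "?h v = v + (v \<bullet> axis n 1) *\<^sub>R axis m 1" for v
      by (simp add: inner_axis) (simp add: vec_eq_iff axis_def)
    \<comment> \<open>The matrix of the shear is the identity with row \<open>n\<close> added to row
      \<open>m\<close>, a row operation that preserves the determinant.\<close>
    have "matrix ?h = (\<chi> k. if k = m then row m (mat 1) + 1 *s row n (mat 1) else row k (mat 1))"
      using \<open>m \<noteq> n\<close> by (auto simp: matrix_def row_def mat_def axis_def vec_eq_iff)
    then have det: "det (matrix ?h) = 1"
      using det_row_operation[OF \<open>m \<noteq> n\<close>, of "mat 1" 1] by simp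
    have "(\<integral>\<^sup>+x. g (?h x) \<partial>lborel) = (\<integral>\<^sup>+x. g x \<partial>lborel)"
      unfolding h using g \<open>m \<noteq> n\<close>
      by (intro nn_integral_lborel_shear) (auto simp: Basis_vec_def axis_eq_axis)
    then show "?Q ?h g" unfolding det by simp
  qed
  then show ?thesis using assms by blast
qed

section \<open>Positive definite matrices\<close>

lemma inner_symmetric_matrix:
  fixes S :: "real ^ 'n ^ 'n"
  assumes "transpose S = S"
  shows "x \<bullet> (S *v y) = (S *v x) \<bullet> y"
  by (metis assms dot_lmul_matrix vector_transpose_matrix)

lemma matrix_inv_eq_mat_1:
  assumes "invertible A"
  shows "A ** matrix_inv A = mat 1" "matrix_inv A ** A = mat 1"
  using someI_ex[OF assms[unfolded invertible_def]] by (auto simp: matrix_inv_def)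

lemma matrix_inverse_unique:
  fixes A B C :: "real ^ 'n ^ 'n"
  assumes "B ** A = mat 1" and "A ** C = mat 1"
  shows "B = C"
proof -
  have "B = B ** (A ** C)" by (simp add: assms(2))
  also have "\<dots> = C" by (simp add: matrix_mul_assoc assms(1))
  finally show ?thesis .
qed

text \<open>Gram-Schmidt for the inner product \<open>x \<bullet> (S *v y)\<close>, by induction on
  the index set. For a proper subset \<open>K\<close> of the indices, the vectors
  \<open>S *v b i\<close> do not span the space; a nonzero vector orthogonal to them in the usual
  sense is scaled to length one in the new inner product.\<close>

lemma positive_definite_orthonormal_system:
  fixes S :: "real ^ 'n ^ 'n" and K :: "'n set"
  assumes S: "positive_definite S"
  shows "\<exists>b :: 'n \<Rightarrow> real ^ 'n. \<forall>i\<in>K. \<forall>j\<in>K. b i \<bullet> (S *v b j) = of_bool (i = j)"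
proof (induction K rule: finite_induct[OF finite])
  case 1
  then show ?case by simp
next
  case (2 k K)
  then obtain b where b: "\<And>i j. i \<in> K \<Longrightarrow> j \<in> K \<Longrightarrow> b i \<bullet> (S *v b j) = of_bool (i = j)"
    by blast
  have sym: "transpose S = S" and pos: "\<And>v. v \<noteq> 0 \<Longrightarrow> v \<bullet> (S *v v) > 0"
    using S by (auto simp: positive_definite_def)
  let ?U = "(\<lambda>i. S *v b i) ` K"
  have "dim ?U \<le> card ?U" by (rule dim_le_card') simp
  also have "\<dots> \<le> card K" by (rule card_image_le) simp
  also have "\<dots> < card (UNIV :: 'n set)"
    using 2 by (intro psubset_card_mono) auto
  finally have "dim ?U < DIM(real ^ 'n)" by simp
  then obtain x where x: "x \<noteq> 0" "\<And>y. y \<in> span ?U \<Longrightarrow> orthogonal x y"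
    using orthogonal_to_subspace_exists by blast
  define v where "v = x /\<^sub>R sqrt (x \<bullet> (S *v x))"
  have vv: "v \<bullet> (S *v v) = 1"
    using pos[OF x(1)] by (simp add: v_def matrix_vector_mult_scaleR field_simps)
  have xb: "x \<bullet> (S *v b i) = 0" if "i \<in> K" for i
    using x(2)[of "S *v b i"] that by (auto simp: orthogonal_def intro: span_base)
  have vb: "v \<bullet> (S *v b i) = 0" if "i \<in> K" for i
    using xb[OF that] by (simp add: v_def)
  have bv: "b i \<bullet> (S *v v) = 0" if "i \<in> K" for i
    using vb[OF that] by (metis inner_symmetric_matrix[OF sym] inner_commute)
  show ?case
    using b vv vb bv 2 by (intro exI[of _ "b(k := v)"]) auto
qed

text \<open>Let \<open>B\<close> have as columns a basis orthonormal for the form of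
  \<open>S\<close>. Then \<open>transpose B ** (S ** B)\<close> is the identity, and solving for
  \<open>S\<close> shows that the transposed inverse of \<open>B\<close> serves as
  \<open>A\<close>.\<close>

lemma positive_definite_factorization:
  fixes S :: "real ^ 'n ^ 'n"
  assumes "positive_definite S"
  obtains A :: "real ^ 'n ^ 'n" where "invertible A" "S = A ** transpose A"
proof -
  obtain b :: "'n \<Rightarrow> real ^ 'n" where b: "\<And>i j. b i \<bullet> (S *v b j) = of_bool (i = j)"
    using positive_definite_orthonormal_system[OF assms, of UNIV] by auto
  define B where "B = transpose (\<chi> i. b i)"
  have "(transpose B ** (S ** B)) $ i $ j = b i \<bullet> (S *v b j)" for i j
    by (simp add: B_def transpose_def matrix_matrix_mult_def matrix_vector_mult_def inner_vec_def)
  then have 1: "transpose B ** (S ** B) = mat 1"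
    by (simp add: vec_eq_iff b mat_def)
  then have "(transpose B ** S) ** B = mat 1" by (simp add: matrix_mul_assoc)
  then have inv: "invertible B" unfolding invertible_left_inverse by blast
  define C where "C = matrix_inv B"
  have C: "C ** B = mat 1" "B ** C = mat 1"
    using matrix_inv_eq_mat_1[OF inv] by (auto simp: C_def)
  have tC: "transpose C ** transpose B = mat 1"
    by (simp add: matrix_transpose_mul[symmetric] C transpose_mat)
  have "S = (transpose C ** transpose B) ** S ** (B ** C)"
    by (simp add: C tC)
  also have "\<dots> = transpose C ** (transpose B ** (S ** B)) ** C"
    by (simp add: matrix_mul_assoc)
  finally have "S = transpose C ** transpose (transpose C)"
    by (simp add: 1)
  moreover have "invertible (transpose C)"
    using tC by (auto simp: invertible_right_inverse)
  ultimately show ?thesis using that by blast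
qed

lemma positive_definite_det:
  fixes S :: "real ^ 'n ^ 'n"
  assumes "positive_definite S" shows "det S > 0"
proof -
  obtain A :: "real ^ 'n ^ 'n" where "invertible A" "S = A ** transpose A"
    using positive_definite_factorization[OF assms] by blast
  then show ?thesis by (auto simp: det_mul invertible_det_nz zero_less_mult_iff)
qed

lemma positive_definite_matrix_inv:
  assumes "positive_definite S"
  shows "S ** matrix_inv S = mat 1" "matrix_inv S ** S = mat 1"
  using matrix_inv_eq_mat_1[of S] positive_definite_det[OF assms] by (auto simp: invertible_det_nz)

text \<open>The difference of the two inverses is symmetric with vanishing quadratic form, so
  polarization makes it zero; equal inverses then force \<open>S = T\<close>.\<close>

lemma positive_definite_quadratic_form_inj:
  assumes S: "positive_definite S" and T: "positive_definite T"
    and eq: "\<And>v. v \<bullet> (matrix_inv S *v v) = v \<bullet> (matrix_inv T *v v)"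
  shows "S = T"
proof -
  have sym: "transpose (matrix_inv R) = matrix_inv R" if R: "positive_definite R" for R :: "real ^ 'n ^ 'n"
  proof -
    have "transpose (R ** matrix_inv R) = mat 1"
      by (simp add: positive_definite_matrix_inv[OF R] transpose_mat)
    then have "transpose (matrix_inv R) ** R = mat 1"
      using R by (simp add: matrix_transpose_mul positive_definite_def)
    then show ?thesis
      using positive_definite_matrix_inv(1)[OF R] by (rule matrix_inverse_unique)
  qed
  let ?D = "matrix_inv S - matrix_inv T"
  have D: "transpose ?D = ?D"
    using sym[OF S] sym[OF T] by (simp add: transpose_def vec_eq_iff)
  have q: "v \<bullet> (?D *v v) = 0" for v
    using eq[of v] by (simp add: matrix_vector_mult_diff_rdistrib inner_diff_right)
  have "u \<bullet> (?D *v v) = 0" for u v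
    using q[of "u + v"] q[of u] q[of v] inner_symmetric_matrix[OF D, of u v]
    by (simp add: matrix_vector_right_distrib inner_add inner_commute)
  \<comment> \<open>Choosing \<open>u\<close> as \<open>?D *v v\<close> turns the vanishing bilinear
    form into a vanishing squared norm.\<close>
  from this[of "?D *v v" v for v] have "?D *v v = 0" for v by simp
  then have "matrix_inv S = matrix_inv T"
    by (simp add: matrix_eq matrix_vector_mult_diff_rdistrib)
  then show ?thesis
    using positive_definite_matrix_inv(1)[OF S] positive_definite_matrix_inv(2)[OF T]
    by (intro matrix_inverse_unique[of S "matrix_inv S" T]) simp_all
qed

section \<open>Gaussian densities\<close>

text \<open>The integrand is the product over the coordinates of one-dimensional standard normal
  densities, each of integral one.\<close>

lemma nn_integral_std_gaussian:
  "(\<integral>\<^sup>+u. ennreal (exp (- (u \<bullet> u) / 2) / sqrt ((2 * pi) ^ CARD('n))) \<partial>(lborel :: (real ^ 'n) measure)) = 1"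
proof -
  have "exp (- (u \<bullet> u) / 2) / sqrt ((2 * pi) ^ CARD('n)) = (\<Prod>b\<in>Basis. std_normal_density (u \<bullet> b))"
    for u :: "real ^ 'n"
  proof -
    have "(\<Prod>b\<in>Basis. std_normal_density (u \<bullet> b)) =
        (1 / sqrt (2 * pi)) ^ CARD('n) * exp (\<Sum>b\<in>Basis. - (u \<bullet> b)\<^sup>2 / 2)"
      by (simp add: std_normal_density_def prod.distrib exp_sum prod_dividef power_one_over)
    also have "(\<Sum>b\<in>Basis. - (u \<bullet> b)\<^sup>2 / 2) = - (u \<bullet> u) / 2"
      by (simp add: euclidean_inner[of u u] sum_negf sum_divide_distrib power2_eq_square)
    finally show ?thesis
      by (simp add: power_one_over real_sqrt_power[symmetric] power_mult_distrib)
  qed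
  then have "(\<integral>\<^sup>+u. ennreal (exp (- (u \<bullet> u) / 2) / sqrt ((2 * pi) ^ CARD('n))) \<partial>(lborel :: (real ^ 'n) measure))
      = (\<integral>\<^sup>+u. (\<Prod>b\<in>Basis. ennreal (std_normal_density (u \<bullet> b))) \<partial>(lborel :: (real ^ 'n) measure))"
    by (simp add: prod_ennreal)
  also have "\<dots> = (\<Prod>b\<in>(Basis :: (real ^ 'n) set). \<integral>\<^sup>+x. ennreal (std_normal_density x) \<partial>lborel)"
    by (rule nn_integral_lborel_prod) auto
  also have "(\<integral>\<^sup>+x. ennreal (std_normal_density x) \<partial>lborel) = 1"
    by (simp add: nn_integral_eq_integral)
  finally show ?thesis by simp
qed

lemma gaussian_density_pos:
  assumes "positive_definite S" shows "gaussian_density m S z > 0"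
  using positive_definite_det[OF assms] by (simp add: gaussian_density_def)

lemma continuous_on_gaussian_density [continuous_intros]:
  "continuous_on U (gaussian_density m S)"
proof -
  have "continuous_on U (\<lambda>z. matrix_inv S *v (z - m))"
    by (rule continuous_on_compose2[OF matrix_vector_mult_linear_continuous_on[of UNIV]])
      (auto intro!: continuous_intros)
  then show ?thesis
    unfolding gaussian_density_def[abs_def]
    by (intro bounded_linear.continuous_on[OF bounded_linear_divide] continuous_intros)
qed

lemma gaussian_density_measurable [measurable]:
  "gaussian_density m S \<in> borel_measurable borel"
  by (intro borel_measurable_continuous_onI continuous_intros)

text \<open>With \<open>S = A ** transpose A\<close>, the substitution \<open>z = A *v u + m\<close>
  reduces the integral to the standard Gaussian: the Jacobian is the absolute value of
  \<open>det A\<close>, which is also the square root of \<open>det S\<close>.\<close>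

lemma nn_integral_gaussian_density:
  fixes m :: "real ^ 'n"
  assumes "positive_definite S"
  shows "(\<integral>\<^sup>+z. ennreal (gaussian_density m S z) \<partial>lborel) = 1"
proof -
  obtain A :: "real ^ 'n ^ 'n" where A: "invertible A" and S: "S = A ** transpose A"
    using positive_definite_factorization[OF assms] by blast
  have detA: "det A \<noteq> 0" using A by (simp add: invertible_det_nz)
  have detS: "det S = (det A)\<^sup>2" by (simp add: S det_mul power2_eq_square)
  \<comment> \<open>Writing \<open>u\<close> as \<open>transpose A *v u'\<close> gives
    \<open>A *v u = S *v u'\<close>, so applying the inverse of \<open>S\<close> returns
    \<open>u'\<close>.\<close>
  have quad: "(A *v u) \<bullet> (matrix_inv S *v (A *v u)) = u \<bullet> u" for u
  proof -
    obtain u' where u: "u = transpose A *v u'"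
      using transpose_invertible[OF A]
      using matrix_inv_eq_mat_1(1)[of "transpose A"]
      by (metis matrix_vector_mul_assoc matrix_vector_mul_lid)
    have "A *v u = S *v u'"
      by (simp only: u S matrix_vector_mul_assoc)
    then have "matrix_inv S *v (A *v u) = u'"
      by (simp add: matrix_vector_mul_assoc positive_definite_matrix_inv(2)[OF assms])
    moreover have "u \<bullet> u = u' \<bullet> (A *v u)"
      by (subst (1) u) (simp add: dot_lmul_matrix)
    ultimately show ?thesis by (simp only: inner_commute)
  qed
  have dens: "gaussian_density m S (A *v u + m) =
      (1 / \<bar>det A\<bar>) * (exp (- (u \<bullet> u) / 2) / sqrt ((2 * pi) ^ CARD('n)))" for u
    unfolding gaussian_density_def by (simp add: quad detS real_sqrt_mult)
  have "(\<integral>\<^sup>+z. ennreal (gaussian_density m S z) \<partial>lborel) =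
      (\<integral>\<^sup>+z. ennreal (gaussian_density m S z) \<partial>distr lborel borel ((+) m))"
    by (simp only: lborel_distr_plus)
  also have "\<dots> = (\<integral>\<^sup>+z. ennreal (gaussian_density m S (z + m)) \<partial>lborel)"
    by (simp add: nn_integral_distr add.commute)
  also have "\<dots> = ennreal \<bar>det A\<bar> * (\<integral>\<^sup>+u. ennreal (gaussian_density m S (A *v u + m)) \<partial>lborel)"
    using nn_integral_lborel_linear[of "(*v) A" "\<lambda>z. ennreal (gaussian_density m S (z + m))"]
    by (simp add: detA)
  also have "\<dots> = ennreal \<bar>det A\<bar> * (ennreal (1 / \<bar>det A\<bar>) * 1)"
    unfolding dens
    by (subst ennreal_mult, simp, simp, subst nn_integral_cmult, simp, simp only: nn_integral_std_gaussian)
  also have "\<dots> = 1"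
    using detA by (simp add: ennreal_mult[symmetric])
  finally show ?thesis .
qed

lemma has_bochner_integral_gaussian_density:
  assumes "positive_definite S"
  shows "has_bochner_integral lborel (gaussian_density m S) 1"
  using gaussian_density_pos[OF assms, of m]
  by (intro has_bochner_integral_nn_integral)
    (auto simp: nn_integral_gaussian_density[OF assms] less_imp_le)

section \<open>Recovering the weight and the parameters from a weighted Gaussian density\<close>

text \<open>The set where two continuous functions differ is open, and a nonempty open set is not
  Lebesgue-null.\<close>

lemma AE_lborel_eq_continuous:
  fixes f g :: "'a::euclidean_space \<Rightarrow> real"
  assumes "continuous_on UNIV f" "continuous_on UNIV g"
    and "AE x in lborel. f x = g x"
  shows "f = g"
proof -
  let ?U = "{x. f x \<noteq> g x}"
  have "open ?U" using assms(1,2) by (rule open_Collect_neq)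
  moreover have "?U \<in> null_sets lborel"
    using assms(3) \<open>open ?U\<close> by (subst AE_iff_null_sets) auto
  then have "negligible ?U"
    by (simp add: negligible_iff_null_sets null_sets_completionI)
  ultimately have "?U = {}" using open_not_negligible by blast
  then show ?thesis by auto
qed

text \<open>With \<open>z - m = S *v v\<close>, the quadratic form in the exponent becomes
  \<open>v \<bullet> (S *v v)\<close>, which is positive by positive definiteness of
  \<open>S\<close> itself.\<close>

lemma gaussian_density_less_mode:
  assumes "positive_definite S" and "z \<noteq> m"
  shows "gaussian_density m S z < gaussian_density m S m"
proof -
  let ?v = "matrix_inv S *v (z - m)"
  have Sv: "S *v ?v = z - m"
    by (simp add: matrix_vector_mul_assoc positive_definite_matrix_inv[OF assms(1)])
  with assms(2) have "?v \<noteq> 0" by auto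
  then have "?v \<bullet> (S *v ?v) > 0"
    using assms(1) unfolding positive_definite_def by blast
  then have "(z - m) \<bullet> ?v > 0" unfolding Sv by (simp add: inner_commute)
  then show ?thesis
    using positive_definite_det[OF assms(1)]
    by (simp add: gaussian_density_def divide_strict_right_mono)
qed

text \<open>Different means would make the common density strictly larger at each of them than at
  the other. Once the means agree, the value at the mode fixes the normalizing constant, and
  cancelling it leaves equality of the quadratic forms.\<close>

lemma gaussian_density_inj:
  assumes S: "positive_definite S" and T: "positive_definite T"
    and eq: "gaussian_density m S = gaussian_density n T"
  shows "m = n" and "S = T"
proof -
  show mn: "m = n"
    using gaussian_density_less_mode[OF S, of n m] gaussian_density_less_mode[OF T, of m n] eq
    by (metis less_asym)
  have r: "sqrt ((2 * pi) ^ CARD('a) * det S) = sqrt ((2 * pi) ^ CARD('a) * det T)"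
    using fun_cong[OF eq, of m] by (simp add: gaussian_density_def mn)
  moreover have "sqrt ((2 * pi) ^ CARD('a) * det T) > 0"
    using positive_definite_det[OF T] by simp
  then have "det T \<noteq> 0" by auto
  ultimately have "v \<bullet> (matrix_inv S *v v) = v \<bullet> (matrix_inv T *v v)" for v
    using fun_cong[OF eq, of "m + v"] unfolding gaussian_density_def mn r
    by simp
  then show "S = T"
    by (rule positive_definite_quadratic_form_inj[OF S T])
qed

text \<open>Continuity upgrades the almost-everywhere equality to equality everywhere. Integrating
  both sides then gives \<open>v = w\<close>, and cancelling this positive weight leaves equal
  Gaussian densities.\<close>

lemma weighted_gaussian_density_inj:
  assumes S: "positive_definite S" and T: "positive_definite T"
    and ae: "AE x in lborel. gaussian_density m S x * v = gaussian_density n T x * w"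
    and "w > 0"
  shows "v = w" and "m = n" and "S = T"
proof -
  have eq: "(\<lambda>x. gaussian_density m S x * v) = (\<lambda>x. gaussian_density n T x * w)"
    using ae by (intro AE_lborel_eq_continuous continuous_intros)
  have "has_bochner_integral lborel (\<lambda>x. gaussian_density m S x * v) (1 * v)"
       "has_bochner_integral lborel (\<lambda>x. gaussian_density n T x * w) (1 * w)"
    by (intro has_bochner_integral_mult_left has_bochner_integral_gaussian_density S T)+
  then show vw: "v = w"
    unfolding eq by (metis has_bochner_integral_eq mult_1)
  have "gaussian_density m S = gaussian_density n T"
    using fun_cong[OF eq] \<open>w > 0\<close> by (auto simp: vw)
  then show "m = n" "S = T" using gaussian_density_inj[OF S T] by auto
qed

section \<open>Cluster-weighted models\<close>

text \<open>Taking the whole component parameter as argument lets \<open>mixture_density\<close>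
  produce the covariate marginal from the same list that describes the joint density.\<close>

fun covariate_density :: "('p::finite, 'd::finite) cwm_param \<Rightarrow> real ^ 'p \<Rightarrow> real" where
  "covariate_density (r, (m, T)) x = gaussian_density m T x"

definition positive_definite_param :: "('p::finite, 'd::finite) cwm_param \<Rightarrow> bool" where
  "positive_definite_param = (\<lambda>((B, S), (m, T)). positive_definite S \<and> positive_definite T)"

lemma cwm_class_altdef:
  "cwm_class \<Theta> = {\<theta> \<in> \<Theta>. is_mixture \<theta> \<and> distinct (map (fst \<circ> fst) \<theta>) \<and>
     (\<forall>(c, w)\<in>set \<theta>. positive_definite_param c)}"
  by (auto simp: cwm_class_def positive_definite_param_def split_beta)

lemma covariate_density_pos: "positive_definite_param c \<Longrightarrow> covariate_density c x > 0"
  by (cases "(c, x)" rule: covariate_density.cases)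
    (auto simp: positive_definite_param_def gaussian_density_pos split_beta)

lemma covariate_weight_pos:
  assumes "\<theta> \<in> cwm_class \<Theta>" and "(c, w) \<in> set \<theta>"
  shows "covariate_density c x * w > 0"
  using assms covariate_density_pos[of c x] by (fastforce simp: cwm_class_altdef is_mixture_def)

lemma cwm_density_eq: "cwm_density c (x, y) = regression_density x (fst c) y * covariate_density c x"
  by (cases "(c, x)" rule: covariate_density.cases) simp

section \<open>Covariate marginals and posterior mixtures\<close>

text \<open>For fixed \<open>x\<close>, the regression factor of each component integrates to one
  over \<open>y\<close>. The hypothesis concerns the covariance matrices only, so it passes to the
  tail in the list induction, whereas the weights of a tail need not sum to one.\<close>

lemma covariate_marginal:
  assumes "\<forall>(c, w)\<in>set \<theta>. positive_definite_param c"
  shows "has_bochner_integral lborel (\<lambda>y. mixture_density cwm_density \<theta> (x, y))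
           (mixture_density covariate_density \<theta> x)"
  using assms
proof (induction \<theta>)
  case Nil
  then show ?case by (simp add: mixture_density_def has_bochner_integral_zero)
next
  case (Cons a \<theta>)
  obtain B S m T w where a: "a = (((B, S), (m, T)), w)" by (metis surj_pair)
  have "has_bochner_integral lborel (regression_density x (B, S)) 1"
    using has_bochner_integral_gaussian_density[of S] Cons.prems
    by (simp add: a positive_definite_param_def cong: has_bochner_integral_cong)
  then have "has_bochner_integral lborel
      (\<lambda>y. regression_density x (B, S) y * (gaussian_density m T x * w)) (1 * (gaussian_density m T x * w))"
    by (rule has_bochner_integral_mult_left)
  then have "has_bochner_integral lborel (\<lambda>y. cwm_density ((B, S), (m, T)) (x, y) * w)
      (gaussian_density m T x * w)"
    by (simp add: mult.assoc)
  from has_bochner_integral_add[OF this Cons.IH] Cons.prems show ?case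
    by (simp add: a mixture_density_def)
qed

text \<open>By Bayes' rule, the conditional density of \<open>y\<close> given \<open>x\<close> is the mixture of regressions with these weights.\<close>

definition posterior_mixture ::
    "(('p::finite, 'd::finite) cwm_param \<times> real) list \<Rightarrow> real ^ 'p \<Rightarrow> (('p, 'd) regression_param \<times> real) list" where
  "posterior_mixture \<theta> x =
     map (\<lambda>(c, w). (fst c, covariate_density c x * w / mixture_density covariate_density \<theta> x)) \<theta>"

lemma posterior_mixture_density:
  "mixture_density (regression_density x) (posterior_mixture \<theta> x) y =
     mixture_density cwm_density \<theta> (x, y) / mixture_density covariate_density \<theta> x"
proof -
  \<comment> \<open>The denominator is generalized to an arbitrary \<open>P\<close>, because the
    marginal itself depends on \<open>\<theta>\<close> and would change during the
    induction.\<close>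
  have "(\<Sum>(c, w)\<leftarrow>\<theta>. regression_density x (fst c) y * (covariate_density c x * w / P)) =
      (\<Sum>(c, w)\<leftarrow>\<theta>. cwm_density c (x, y) * w) / P" for P
    by (induction \<theta>) (auto simp: cwm_density_eq add_divide_distrib)
  then show ?thesis
    by (simp add: mixture_density_def posterior_mixture_def o_def case_prod_unfold)
qed

lemma marginal_density_pos:
  assumes "\<theta> \<in> cwm_class \<Theta>"
  shows "mixture_density covariate_density \<theta> x > 0"
proof -
  have "\<theta> \<noteq> []" using assms by (auto simp: cwm_class_def is_mixture_def)
  moreover have "\<forall>(c, w)\<in>set \<theta>. covariate_density c x * w > 0"
    using covariate_weight_pos[OF assms] by blast
  ultimately show ?thesis
    unfolding mixture_density_def
    by (induction \<theta> rule: list_nonempty_induct) (auto intro: add_pos_pos)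
qed

text \<open>This makes identifiability at fixed \<open>x\<close> applicable. The regression
  parameters are those of \<open>\<theta>\<close> in the same order, hence distinct by the
  definition of \<open>cwm_class\<close>; division by the positive marginal makes the weights sum to
  one.\<close>

lemma posterior_mixture_in_regression_class:
  assumes "\<theta> \<in> cwm_class \<Theta>"
  shows "posterior_mixture \<theta> x \<in> regression_class \<Theta>"
proof -
  let ?P = "mixture_density covariate_density \<theta> x"
  have P: "?P > 0" by (rule marginal_density_pos[OF assms])
  have map: "map fst (posterior_mixture \<theta> x) = map (fst \<circ> fst) \<theta>"
    by (simp add: posterior_mixture_def split_beta)
  have "(\<Sum>(c, w)\<leftarrow>\<theta>. covariate_density c x * w / Q) = mixture_density covariate_density \<theta> x / Q" for Q
    unfolding mixture_density_def by (induction \<theta>) (auto simp: add_divide_distrib)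
  from this[of ?P] P have "(\<Sum>(\<psi>, w)\<leftarrow>posterior_mixture \<theta> x. w) = 1"
    by (simp add: posterior_mixture_def o_def case_prod_unfold)
  moreover have "\<forall>(\<psi>, w)\<in>set (posterior_mixture \<theta> x). w > 0"
    using covariate_weight_pos[OF assms] P
    by (auto simp: posterior_mixture_def simp del: covariate_density.simps)
  ultimately have "is_mixture (posterior_mixture \<theta> x)"
    using assms by (auto simp: is_mixture_def map cwm_class_def)
  with assms map show ?thesis
    by (auto simp: regression_class_def)
qed

section \<open>Matching the components of two equal joint densities\<close>

theorem theorem1:
  fixes \<Theta> :: "(('p::finite, 'd::finite) cwm_param \<times> real) list set"
    and X :: "(real ^ 'p) set"
    and \<mu> :: "real ^ 'p" and \<Sigma> :: "real ^ 'p ^ 'p"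
  assumes "positive_definite \<Sigma>"
    and "AE x in gaussian_measure \<mu> \<Sigma>. x \<in> X"
    and "\<And>x. x \<in> X \<Longrightarrow>
           identifiable_on (UNIV :: (real ^ 'd) set) (regression_density x) (regression_class \<Theta>)"
  shows "identifiable_on (X \<times> (UNIV :: (real ^ 'd) set)) cwm_density (cwm_class \<Theta>)"
  unfolding identifiable_on_def
proof (intro ballI impI)
  fix \<theta> \<theta>' :: "(('p, 'd) cwm_param \<times> real) list"
  assume \<theta>: "\<theta> \<in> cwm_class \<Theta>" and \<theta>': "\<theta>' \<in> cwm_class \<Theta>"
    and "\<forall>z\<in>X \<times> UNIV. mixture_density cwm_density \<theta> z = mixture_density cwm_density \<theta>' z"
  then have eq: "mixture_density cwm_density \<theta> (x, y) = mixture_density cwm_density \<theta>' (x, y)"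
    if "x \<in> X" for x y using that by auto
  \<comment> \<open>A Gaussian density is positive everywhere, so almost everywhere for the Gaussian
    measure implies almost everywhere for Lebesgue measure.\<close>
  have ae: "AE x in lborel. x \<in> X"
    using assms(2) unfolding gaussian_measure_def
    by (subst (asm) AE_density) (auto simp: gaussian_density_pos[OF assms(1)])
  have "X \<noteq> {}"
  proof
    assume "X = {}"
    with ae have "AE x in (lborel :: (real ^ 'p) measure). False" by simp
    then show False by (simp add: eventually_False ae_filter_eq_bot_iff)
  qed
  then obtain x\<^sub>0 where x\<^sub>0: "x\<^sub>0 \<in> X" by blast
  \<comment> \<open>Both marginals are integrals over \<open>y\<close> of the same function, since
    the joint densities agree above \<open>x\<close>.\<close>
  have marg: "mixture_density covariate_density \<theta> x = mixture_density covariate_density \<theta>' x"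
    if "x \<in> X" for x
  proof (rule has_bochner_integral_eq)
    show "has_bochner_integral lborel (\<lambda>y. mixture_density cwm_density \<theta> (x, y))
        (mixture_density covariate_density \<theta> x)"
      using \<theta> by (intro covariate_marginal) (auto simp: cwm_class_altdef)
    have "has_bochner_integral lborel (\<lambda>y. mixture_density cwm_density \<theta>' (x, y))
        (mixture_density covariate_density \<theta>' x)"
      using \<theta>' by (intro covariate_marginal) (auto simp: cwm_class_altdef)
    then show "has_bochner_integral lborel (\<lambda>y. mixture_density cwm_density \<theta> (x, y))
        (mixture_density covariate_density \<theta>' x)"
      by (simp add: eq[OF that])
  qed
  \<comment> \<open>Posterior weights are matched first; the marginals coincide, so the common
    nonzero denominator cancels. The index \<open>s\<close> obtained here may still depend on
    \<open>x\<close>.\<close>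
  have match: "length \<theta> = length \<theta>' \<and> (\<forall>g<length \<theta>. \<exists>s<length \<theta>'.
      covariate_density (fst (\<theta> ! g)) x * snd (\<theta> ! g) = covariate_density (fst (\<theta>' ! s)) x * snd (\<theta>' ! s) \<and>
      fst (fst (\<theta> ! g)) = fst (fst (\<theta>' ! s)))" if x: "x \<in> X" for x
  proof -
    have "mixture_density (regression_density x) (posterior_mixture \<theta> x) y =
        mixture_density (regression_density x) (posterior_mixture \<theta>' x) y" for y
      by (simp add: posterior_mixture_density marg[OF x] eq[OF x])
    then have len: "length (posterior_mixture \<theta> x) = length (posterior_mixture \<theta>' x)"
      and ex: "\<forall>g<length (posterior_mixture \<theta> x). \<exists>s<length (posterior_mixture \<theta>' x).
        snd (posterior_mixture \<theta> x ! g) = snd (posterior_mixture \<theta>' x ! s) \<and>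
        fst (posterior_mixture \<theta> x ! g) = fst (posterior_mixture \<theta>' x ! s)"
      using assms(3)[OF x, unfolded identifiable_on_def] \<theta> \<theta>' posterior_mixture_in_regression_class
      by blast+
    have nth: "fst (posterior_mixture \<eta> x ! g) = fst (fst (\<eta> ! g))"
      "snd (posterior_mixture \<eta> x ! g) =
         covariate_density (fst (\<eta> ! g)) x * snd (\<eta> ! g) / mixture_density covariate_density \<eta> x"
      if "g < length \<eta>" for \<eta> :: "(('p, 'd) cwm_param \<times> real) list" and g
      using that by (auto simp: posterior_mixture_def split_beta)
    have length: "length (posterior_mixture \<eta> x) = length \<eta>"
      for \<eta> :: "(('p, 'd) cwm_param \<times> real) list"
      by (simp add: posterior_mixture_def)
    have nz: "mixture_density covariate_density \<theta>' x \<noteq> 0"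
      using marginal_density_pos[OF \<theta>', of x] by simp
    show ?thesis
    proof (intro conjI allI impI)
      show "length \<theta> = length \<theta>'" using len by (simp add: length)
      fix g assume g: "g < length \<theta>"
      then obtain s where "s < length \<theta>'"
        "snd (posterior_mixture \<theta> x ! g) = snd (posterior_mixture \<theta>' x ! s)"
        "fst (posterior_mixture \<theta> x ! g) = fst (posterior_mixture \<theta>' x ! s)"
        using ex by (auto simp: length)
      with g nz show "\<exists>s<length \<theta>'. covariate_density (fst (\<theta> ! g)) x * snd (\<theta> ! g) =
          covariate_density (fst (\<theta>' ! s)) x * snd (\<theta>' ! s) \<and> fst (fst (\<theta> ! g)) = fst (fst (\<theta>' ! s))"
        by (intro exI[of _ s]) (simp add: nth marg[OF x])
    qed
  qed
  have "\<exists>s<length \<theta>'. snd (\<theta> ! g) = snd (\<theta>' ! s) \<and> fst (\<theta> ! g) = fst (\<theta>' ! s)"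
    if g: "g < length \<theta>" for g
  proof -
    \<comment> \<open>The index is fixed once, at the reference point \<open>x\<^sub>0\<close>, and
      is then shown to serve every \<open>x\<close> in \<open>X\<close>.\<close>
    obtain s where s: "s < length \<theta>'" and reg: "fst (fst (\<theta> ! g)) = fst (fst (\<theta>' ! s))"
      using match[OF x\<^sub>0] g by blast
    have dist: "distinct (map (fst \<circ> fst) \<theta>')" using \<theta>' by (simp add: cwm_class_def)
    have "covariate_density (fst (\<theta> ! g)) x * snd (\<theta> ! g) =
        covariate_density (fst (\<theta>' ! s)) x * snd (\<theta>' ! s)" if x: "x \<in> X" for x
    proof -
      obtain t where t: "t < length \<theta>'" "fst (fst (\<theta> ! g)) = fst (fst (\<theta>' ! t))"
        "covariate_density (fst (\<theta> ! g)) x * snd (\<theta> ! g) =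
         covariate_density (fst (\<theta>' ! t)) x * snd (\<theta>' ! t)"
        using match[OF x] g by blast
      \<comment> \<open>Both indices carry the regression parameter of component \<open>g\<close>,
        which occurs only once in \<open>\<theta>'\<close>.\<close>
      have "t = s"
        using t(1,2) s reg nth_eq_iff_index_eq[OF dist, of t s] by simp
      with t(3) show ?thesis by simp
    qed
    with ae have ae': "AE x in lborel. covariate_density (fst (\<theta> ! g)) x * snd (\<theta> ! g) =
        covariate_density (fst (\<theta>' ! s)) x * snd (\<theta>' ! s)"
      by (auto elim: eventually_mono)
    obtain r m T w where 1: "\<theta> ! g = ((r, (m, T)), w)" by (metis surj_pair)
    obtain r' m' T' w' where 2: "\<theta>' ! s = ((r', (m', T')), w')" by (metis surj_pair)
    have in1: "((r, (m, T)), w) \<in> set \<theta>" and in2: "((r', (m', T')), w') \<in> set \<theta>'"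
      using g s 1 2 by (metis nth_mem)+
    have T: "positive_definite T" and T': "positive_definite T'" and w': "w' > 0"
      using in1 in2 \<theta> \<theta>' by (auto simp: cwm_class_def is_mixture_def split_beta)
    have "AE x in lborel. gaussian_density m T x * w = gaussian_density m' T' x * w'"
      using ae' by (simp add: 1 2)
    from weighted_gaussian_density_inj[OF T T' this w'] reg s show ?thesis
      by (auto simp: 1 2)
  qed
  with match[OF x\<^sub>0] show "length \<theta> = length \<theta>' \<and>
      (\<forall>g<length \<theta>. \<exists>s<length \<theta>'. snd (\<theta> ! g) = snd (\<theta>' ! s) \<and> fst (\<theta> ! g) = fst (\<theta>' ! s))"
    by blast
qed

end
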